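(* Let $H$ be a real Hilbert space, let $A\subset H$ be a closed and convex set, and let $B\subset H$ be a closed and convex cone such that $A\cap \operatorname{int}B\neq\emptyset$. Let $e\in\operatorname{int}B$ and $\gamma>0$ be such that $A\cap(B+\gamma e)\neq\emptyset$. Let $z_0\in H$ and $\alpha,\beta\in(0,1)$, and let $\{w_n\}$ and $\{z_n\}$ be the sequences generated from $z_0$ by $$w_n=P_A(z_n),\qquad z_{n+1}=T_{A,B+\gamma e,\alpha,\beta}(z_n),\qquad n=0,1,2,\dots.$$ Then $\{w_n\}$ terminates finitely to a point of $A\cap\operatorname{int}B$; that is, there exists $l_0\in\mathbb{N}$ such that $w_l\in A\cap\operatorname{int}B$ for all $l\ge l_0$.
   Context: $H$ is a real Hilbert space with norm $\|\cdot\|$. $\operatorname{int}B$ denotes the interior of $B$. For $C\subset H$ and $p\in H$, $C+p=\{c+p:c\in C\}$. For a nonempty closed convex set $C\subset H$, $P_C$ denotes the metric projection onto $C$: $P_C(x)$ is the unique minimizer of $\|x-y\|$ over $y\in C$. For nonempty closed convex sets $C,D\subset H$ and $\alpha,\beta\in(0,1)$, the averaged alternating modified reflections (AAMR) operator $T_{C,D,\alpha,\beta}:H\to H$ is $$T_{C,D,\alpha,\beta}=(1-\alpha)I+\alpha(2\beta P_D-I)(2\beta P_C-I),$$ where $I$ is the identity mapping and juxtaposition denotes composition. *)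

theory Defs
  imports "HOL-Analysis.Analysis"
begin

(* The library's closest_point is restricted to sort heine_borel, which would force a
   Hilbert space to be finite-dimensional. The description below denotes the projection
   whenever C is nonempty, closed and convex and the space is complete. *)
definition metric_proj :: "'a::real_inner set \<Rightarrow> 'a \<Rightarrow> 'a" where
  "metric_proj C x = (THE y. y \<in> C \<and> (\<forall>c\<in>C. norm (x - y) \<le> norm (x - c)))"

definition mod_refl :: "'a::real_inner set \<Rightarrow> real \<Rightarrow> 'a \<Rightarrow> 'a" where
  "mod_refl C \<beta> x = (2 * \<beta>) *\<^sub>R metric_proj C x - x"

definition AAMR :: "'a::real_inner set \<Rightarrow> 'a set \<Rightarrow> real \<Rightarrow> real \<Rightarrow> 'a \<Rightarrow> 'a" where
  "AAMR C D \<alpha> \<beta> x = (1 - \<alpha>) *\<^sub>R x + \<alpha> *\<^sub>R (mod_refl D \<beta> \<circ> mod_refl C \<beta>) x"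

end

theory Submission
  imports Defs
begin

text \<open>
  Put \<open>D = B + \<gamma>e\<close> and let \<open>T\<close> be the AAMR operator of \<open>A\<close> and \<open>D\<close>. A ball around \<open>\<gamma>e\<close> lies
  in \<open>B\<close>, so every point close enough to \<open>D\<close> is interior to \<open>B\<close>; hence it suffices that the
  distance of \<open>w\<^sub>n\<close> to \<open>D\<close> tends to \<open>0\<close>. As \<open>T x - x\<close> equals
  \<open>2\<alpha>\<beta> (P\<^sub>D (2\<beta> P\<^sub>A x - x) - P\<^sub>A x)\<close>, this follows from \<open>z\<^sub>n - T z\<^sub>n \<rightarrow> 0\<close>. The operator \<open>T\<close>
  is averaged, so it is asymptotically regular in this sense as soon as it has approximate fixed
  points. The existence of exact fixed points would require a constraint qualification for \<open>A\<close> and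
  \<open>D\<close>, but approximate ones need only \<open>A \<inter> D \<noteq> {}\<close>: the fixed points of the contractions
  \<open>t T\<close>, as \<open>t \<rightarrow> 1\<close>, will do.
\<close>

section \<open>Projections in Hilbert spaces\<close>

text \<open>Parallelogram identity for \<open>c - x\<close> and \<open>c - y\<close>. It makes
  near-minimizers of the distance to a convex set cluster.\<close>

lemma norm_diff_le_midpoint:
  fixes x y c :: "'a::real_inner"
  assumes "0 \<le> d" and "d \<le> norm (c - (1/2) *\<^sub>R (x + y))" and "norm (c - x) \<le> r" and "norm (c - y) \<le> r"
  shows "(norm (x - y))\<^sup>2 \<le> 4 * (r\<^sup>2 - d\<^sup>2)"
proof -
  define m where "m = norm (c - (1/2) *\<^sub>R (x + y))"
  have "(norm (x - y))\<^sup>2 = 2 * (norm (c - x))\<^sup>2 + 2 * (norm (c - y))\<^sup>2 - 4 * m\<^sup>2"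
    unfolding m_def power2_norm_eq_inner by (simp add: inner_simps inner_commute algebra_simps)
  moreover have "(norm (c - x))\<^sup>2 \<le> r\<^sup>2" "(norm (c - y))\<^sup>2 \<le> r\<^sup>2"
    "d\<^sup>2 \<le> m\<^sup>2"
    using assms by (auto simp: m_def intro!: power_mono)
  ultimately show ?thesis by (simp add: right_diff_distrib)
qed

text \<open>Completeness stands in for compactness: the near-minimizers in \<open>C\<close> form
  nested closed sets whose diameters shrink to 0, so they have a common point.\<close>

lemma ex_nearest_point:
  fixes C :: "'a::{real_inner, complete_space} set"
  assumes "closed C" and "convex C" and "C \<noteq> {}"
  obtains y where "y \<in> C" and "\<And>c. c \<in> C \<Longrightarrow> dist x y \<le> dist x c"
proof -
  define d where "d = infdist x C"
  \<comment> \<open>The positive slack keeps \<open>S n\<close> nonempty before the infimum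
    \<open>d\<close> is known to be attained.\<close>
  define r where "r n = d + inverse (real (Suc n))" for n
  define S where "S n = C \<inter> cball x (r n)" for n
  have r_lim: "(\<lambda>n. d + inverse (real (Suc n))) \<longlonglongrightarrow> d"
    using tendsto_add[OF tendsto_const LIMSEQ_inverse_real_of_nat, of d] by simp
  obtain a where a: "\<And>n. a \<in> S n"
  proof (rule decreasing_closed_nest)
    show "closed (S n)" for n unfolding S_def using assms(1) by auto
    show "S n \<noteq> {}" for n
    proof -
      have "(INF c\<in>C. dist x c) < r n"
        using assms(3) by (simp add: r_def d_def infdist_notempty)
      then obtain c where "c \<in> C" "dist x c < r n"
        using assms(3) by (subst (asm) cINF_less_iff) (auto intro: bdd_belowI2[of _ 0])
      then show ?thesis by (auto simp: S_def)
    qed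
    show "S n \<subseteq> S m" if "m \<le> n" for m n
    proof -
      have "r n \<le> r m" using that by (auto simp: r_def intro!: le_imp_inverse_le)
      then show ?thesis by (auto simp: S_def)
    qed
    show "\<exists>n. \<forall>y\<in>S n. \<forall>z\<in>S n. dist y z < \<epsilon>" if "\<epsilon> > 0" for \<epsilon>
    proof -
      have "(\<lambda>n. 4 * ((r n)\<^sup>2 - d\<^sup>2)) \<longlonglongrightarrow> 4 * (d\<^sup>2 - d\<^sup>2)"
        unfolding r_def by (intro tendsto_intros r_lim)
      then have "\<forall>\<^sub>F n in sequentially. 4 * ((r n)\<^sup>2 - d\<^sup>2) < \<epsilon>\<^sup>2"
        using that by (intro order_tendstoD(2)) auto
      then obtain n where n: "4 * ((r n)\<^sup>2 - d\<^sup>2) < \<epsilon>\<^sup>2"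
        by (auto simp: eventually_sequentially)
      have "dist y z < \<epsilon>" if "y \<in> S n" "z \<in> S n" for y z
      proof -
        \<comment> \<open>By convexity the midpoint also competes for the distance, so it lies at
          least \<open>d\<close> from \<open>x\<close>.\<close>
        have "(1/2) *\<^sub>R (y + z) \<in> C"
          using convexD[OF assms(2), of y z "1/2" "1/2"] that by (auto simp: S_def scaleR_add_right)
        then have "d \<le> norm (x - (1/2) *\<^sub>R (y + z))"
          unfolding d_def using infdist_le by (metis dist_norm)
        then have "(norm (y - z))\<^sup>2 \<le> 4 * ((r n)\<^sup>2 - d\<^sup>2)"
          using that by (intro norm_diff_le_midpoint) (auto simp: S_def d_def infdist_nonneg dist_norm)
        with n have "(norm (y - z))\<^sup>2 < \<epsilon>\<^sup>2" by linarith
        then show ?thesis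
          using \<open>\<epsilon> > 0\<close> power2_less_imp_less[of "norm (y - z)" \<epsilon>] by (simp add: dist_norm)
      qed
      then show ?thesis by blast
    qed
  qed blast
  have "dist x a \<le> d"
  proof (rule LIMSEQ_le_const[OF r_lim])
    show "\<exists>N. \<forall>n\<ge>N. dist x a \<le> d + inverse (real (Suc n))"
      using a by (auto simp: S_def r_def)
  qed
  then have "dist x a \<le> dist x c" if "c \<in> C" for c
    using infdist_le[OF that, of x] by (simp add: d_def)
  moreover have "a \<in> C" using a by (auto simp: S_def)
  ultimately show thesis using that by blast
qed

text \<open>Justifies the definite description: existence comes from completeness, uniqueness from
  convexity.\<close>

lemma metric_proj_nearest:
  fixes C :: "'a::{real_inner, complete_space} set"
  assumes "closed C" and "convex C" and "C \<noteq> {}"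
  shows metric_proj_in: "metric_proj C x \<in> C"
    and metric_proj_le: "c \<in> C \<Longrightarrow> dist x (metric_proj C x) \<le> dist x c"
proof -
  obtain y where y: "y \<in> C" "\<And>c. c \<in> C \<Longrightarrow> dist x y \<le> dist x c"
    using ex_nearest_point[OF assms] by blast
  have "metric_proj C x \<in> C \<and> (\<forall>c\<in>C. norm (x - metric_proj C x) \<le> norm (x - c))"
    unfolding metric_proj_def
  proof (rule theI)
    show "y \<in> C \<and> (\<forall>c\<in>C. norm (x - y) \<le> norm (x - c))"
      using y by (auto simp: dist_norm)
    show "y' = y" if "y' \<in> C \<and> (\<forall>c\<in>C. norm (x - y') \<le> norm (x - c))" for y'
      using that y any_closest_point_unique[OF assms(2,1), of y' y x] by (auto simp: dist_norm)
  qed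
  then show "metric_proj C x \<in> C" "c \<in> C \<Longrightarrow> dist x (metric_proj C x) \<le> dist x c"
    by (auto simp: dist_norm)
qed

lemma metric_proj_inner_le:
  fixes C :: "'a::{real_inner, complete_space} set"
  assumes "closed C" and "convex C" and "c \<in> C"
  shows "inner (x - metric_proj C x) (c - metric_proj C x) \<le> 0"
  using assms metric_proj_nearest[of C] by (intro any_closest_point_dot[of C]) auto

lemma mod_refl_nonexpansive:
  fixes C :: "'a::{real_inner, complete_space} set"
  assumes "closed C" and "convex C" and "C \<noteq> {}" and "0 \<le> \<beta>" and "\<beta> \<le> 1"
  shows "norm (mod_refl C \<beta> x - mod_refl C \<beta> y) \<le> norm (x - y)"
proof -
  define p q where "p = metric_proj C x" and "q = metric_proj C y"
  have "inner (x - p) (q - p) \<le> 0" "inner (y - q) (p - q) \<le> 0"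
    using metric_proj_inner_le[OF assms(1,2)] metric_proj_in[OF assms(1,2,3)]
    by (auto simp: p_def q_def)
  \<comment> \<open>The sum of the two variational inequalities: the projection is firmly
    nonexpansive.\<close>
  then have firm: "inner (p - q) (p - q) \<le> inner (p - q) (x - y)"
    by (simp add: inner_simps inner_commute algebra_simps)
  have "(norm (mod_refl C \<beta> x - mod_refl C \<beta> y))\<^sup>2 = (norm ((2 * \<beta>) *\<^sub>R (p - q) - (x - y)))\<^sup>2"
    by (simp add: mod_refl_def p_def q_def algebra_simps)
  also have "\<dots> = 4 * \<beta>\<^sup>2 * inner (p - q) (p - q) - 4 * \<beta> * inner (p - q) (x - y) + (norm (x - y))\<^sup>2"
    unfolding power2_norm_eq_inner inner_diff_left[of "(2 * \<beta>) *\<^sub>R (p - q)"]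
      inner_diff_right[of _ "(2 * \<beta>) *\<^sub>R (p - q)"]
    by (simp add: inner_commute[of "x - y" "p - q"] power2_eq_square)
  also have "\<dots> \<le> (norm (x - y))\<^sup>2"
  proof -
    \<comment> \<open>Since \<beta> lies in [0,1], the quadratic term is absorbed by the cross term
      through firmness.\<close>
    have "\<beta>\<^sup>2 * inner (p - q) (p - q) \<le> \<beta> * inner (p - q) (p - q)"
      using assms(4,5) by (intro mult_right_mono) (auto simp: power2_eq_square mult_left_le)
    also have "\<dots> \<le> \<beta> * inner (p - q) (x - y)"
      using firm assms(4) by (rule mult_left_mono)
    finally show ?thesis by simp
  qed
  finally show ?thesis by (rule power2_le_imp_le) simp
qed

section \<open>Asymptotic regularity of averaged operators\<close>

text \<open>Expanding the square leaves the slack \<alpha>(1-\<alpha>) times the squared norm of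
  \<open>u - v\<close>. It is stated through \<alpha>(u - v) because, for an averaged map, that is
  the difference of two displacements.\<close>

lemma relaxation_norm_le:
  fixes u v :: "'a::real_inner"
  assumes "0 < \<alpha>" and "norm v \<le> norm u"
  shows "(norm ((1 - \<alpha>) *\<^sub>R u + \<alpha> *\<^sub>R v))\<^sup>2 + (1 - \<alpha>) / \<alpha> * (norm (\<alpha> *\<^sub>R (u - v)))\<^sup>2 \<le> (norm u)\<^sup>2"
proof -
  have "(1 - \<alpha>) / \<alpha> * (norm (\<alpha> *\<^sub>R (u - v)))\<^sup>2 = \<alpha> * (1 - \<alpha>) * inner (u - v) (u - v)"
    using assms(1) unfolding power2_norm_eq_inner by simp
  then have "(norm ((1 - \<alpha>) *\<^sub>R u + \<alpha> *\<^sub>R v))\<^sup>2 + (1 - \<alpha>) / \<alpha> * (norm (\<alpha> *\<^sub>R (u - v)))\<^sup>2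
      = (1 - \<alpha>) * (norm u)\<^sup>2 + \<alpha> * (norm v)\<^sup>2"
    unfolding power2_norm_eq_inner
    by (simp add: inner_simps inner_commute algebra_simps power2_eq_square)
  moreover have "\<alpha> * (norm v)\<^sup>2 \<le> \<alpha> * (norm u)\<^sup>2"
    using assms by (intro mult_left_mono power_mono) auto
  ultimately show ?thesis by (simp add: algebra_simps)
qed

text \<open>The orbit of \<open>x\<close> is compared with that of an approximate fixed point
  \<open>y\<close>: the displacements along the two orbits become equal in the limit, and those
  along the second stay small.\<close>

lemma asymptotically_regular:
  fixes T :: "'a::real_normed_vector \<Rightarrow> 'a"
  assumes "\<kappa> > 0"
    and averaged: "\<And>x y. (norm (T x - T y))\<^sup>2 + \<kappa> * (norm ((x - T x) - (y - T y)))\<^sup>2 \<le> (norm (x - y))\<^sup>2"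
    and approx_fix: "\<And>\<epsilon>. \<epsilon> > 0 \<Longrightarrow> \<exists>y. norm (y - T y) < \<epsilon>"
  shows "(\<lambda>n. (T ^^ n) x - T ((T ^^ n) x)) \<longlonglongrightarrow> 0"
proof (rule LIMSEQ_I)
  fix \<epsilon> :: real
  assume "\<epsilon> > 0"
  then obtain y where y: "norm (y - T y) < \<epsilon> / 2"
    using approx_fix[of "\<epsilon> / 2"] by auto
  define X Y where "X n = (T ^^ n) x" and "Y n = (T ^^ n) y" for n
  define d where "d n = (norm (X n - Y n))\<^sup>2" for n
  have d: "d (Suc n) + \<kappa> * (norm ((X n - T (X n)) - (Y n - T (Y n))))\<^sup>2 \<le> d n" for n
    using averaged by (simp add: d_def X_def Y_def)
  have "d (Suc n) \<le> d n" for n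
    using order_trans[OF _ d[of n], of "d (Suc n)"] \<open>\<kappa> > 0\<close> by simp
  then have "decseq d" by (rule decseq_SucI)
  moreover have "0 \<le> d n" for n by (simp add: d_def)
  ultimately have "convergent d"
    by (metis decseq_convergent convergentI)
  then obtain l where "d \<longlonglongrightarrow> l" by (auto simp: convergent_def)
  \<comment> \<open>Decrements of a convergent sequence vanish, and by \<open>d\<close> they control
    the difference of the displacements.\<close>
  then have "(\<lambda>n. (d n - d (Suc n)) / \<kappa>) \<longlonglongrightarrow> (l - l) / \<kappa>"
    using \<open>\<kappa> > 0\<close> by (intro tendsto_intros LIMSEQ_Suc) auto
  then have "\<forall>\<^sub>F n in sequentially. (d n - d (Suc n)) / \<kappa> < (\<epsilon> / 2)\<^sup>2"
    using \<open>\<epsilon> > 0\<close> by (intro order_tendstoD(2)[where y = "(l - l) / \<kappa>"]) auto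
  then obtain N where N: "(d n - d (Suc n)) / \<kappa> < (\<epsilon> / 2)\<^sup>2" if "n \<ge> N" for n
    by (auto simp: eventually_sequentially)
  \<comment> \<open>Nonexpansiveness of \<open>T\<close> keeps displacements from growing along an
    orbit.\<close>
  have Y_small: "norm (Y n - T (Y n)) < \<epsilon> / 2" for n
  proof (induction n)
    case 0
    show ?case using y by (simp add: Y_def)
  next
    case (Suc n)
    have "(norm (T (Y n) - T (T (Y n))))\<^sup>2 \<le> (norm (Y n - T (Y n)))\<^sup>2"
      using order_trans[OF _ averaged[of "Y n" "T (Y n)"], of "(norm (T (Y n) - T (T (Y n))))\<^sup>2"]
        \<open>\<kappa> > 0\<close> by simp
    then have "norm (T (Y n) - T (T (Y n))) \<le> norm (Y n - T (Y n))"
      by (rule power2_le_imp_le) simp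
    with Suc show ?case by (simp add: Y_def)
  qed
  have "norm (X n - T (X n) - 0) < \<epsilon>" if "n \<ge> N" for n
  proof -
    have "(norm ((X n - T (X n)) - (Y n - T (Y n))))\<^sup>2 \<le> (d n - d (Suc n)) / \<kappa>"
      using d[of n] \<open>\<kappa> > 0\<close> by (simp add: field_simps)
    also have "\<dots> < (\<epsilon> / 2)\<^sup>2" using N[OF that] .
    finally have "norm ((X n - T (X n)) - (Y n - T (Y n))) < \<epsilon> / 2"
      by (rule power2_less_imp_less) (use \<open>\<epsilon> > 0\<close> in simp)
    then show ?thesis
      using Y_small[of n] norm_triangle_ineq[of "(X n - T (X n)) - (Y n - T (Y n))" "Y n - T (Y n)"]
      by simp
  qed
  then show "\<exists>N. \<forall>n\<ge>N. norm ((T ^^ n) x - T ((T ^^ n) x) - 0) < \<epsilon>"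
    by (auto simp: X_def)
qed

section \<open>The AAMR operator\<close>

lemma AAMR_diff:
  "AAMR C D \<alpha> \<beta> x - x =
    (2 * \<alpha> * \<beta>) *\<^sub>R (metric_proj D (mod_refl C \<beta> x) - metric_proj C x)"
  by (simp add: AAMR_def mod_refl_def algebra_simps)

lemma AAMR_averaged:
  fixes C D :: "'a::{real_inner, complete_space} set"
  assumes "closed C" "convex C" "C \<noteq> {}" and "closed D" "convex D" "D \<noteq> {}"
    and "0 < \<alpha>" and "0 \<le> \<beta>" "\<beta> \<le> 1"
  defines "T \<equiv> AAMR C D \<alpha> \<beta>"
  shows "(norm (T x - T y))\<^sup>2 + (1 - \<alpha>) / \<alpha> * (norm ((x - T x) - (y - T y)))\<^sup>2 \<le> (norm (x - y))\<^sup>2"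
proof -
  define N where "N = mod_refl D \<beta> \<circ> mod_refl C \<beta>"
  have "norm (N x - N y) \<le> norm (x - y)"
    unfolding N_def o_def
    using mod_refl_nonexpansive[OF assms(4-6,8,9)] mod_refl_nonexpansive[OF assms(1-3,8,9)]
    by (rule order_trans)
  note relaxation_norm_le[OF assms(7) this]
  moreover have "T x - T y = (1 - \<alpha>) *\<^sub>R (x - y) + \<alpha> *\<^sub>R (N x - N y)"
    "(x - T x) - (y - T y) = \<alpha> *\<^sub>R ((x - y) - (N x - N y))"
    by (simp_all add: T_def AAMR_def N_def algebra_simps)
  ultimately show ?thesis by simp
qed

text \<open>
  Adding the variational inequalities of the two projections at a common point \<open>p\<close>; since \<open>\<beta> < 1\<close>,
  a negative definite quadratic form in the projections dominates and gives a bound in terms of \<open>p\<close>.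
\<close>

lemma metric_proj_gap_inner_le:
  fixes C D :: "'a::{real_inner, complete_space} set"
  assumes "closed C" "convex C" and "closed D" "convex D" and p: "p \<in> C" "p \<in> D"
    and "0 \<le> \<beta>" and "\<beta> < 1"
  shows "inner y (metric_proj D (mod_refl C \<beta> y) - metric_proj C y) \<le> (norm p)\<^sup>2 / (2 * (1 - \<beta>))"
proof -
  define a where "a = metric_proj C y"
  define b where "b = metric_proj D (mod_refl C \<beta> y)"
  have "inner (y - a) (p - a) \<le> 0" "inner ((2 * \<beta>) *\<^sub>R a - y - b) (p - b) \<le> 0"
    using metric_proj_inner_le[OF assms(1,2) p(1)] metric_proj_inner_le[OF assms(3,4) p(2)]
    by (auto simp: a_def b_def mod_refl_def)
  \<comment> \<open>Adding the two inequalities cancels \<open>inner y p\<close>, so the right-hand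
    side is free of \<open>y\<close>.\<close>
  then have "inner y (b - a) \<le> (1 - 2 * \<beta>) * inner a p + inner b p
      - inner a a - inner b b + 2 * \<beta> * inner a b"
    by (simp add: inner_simps inner_commute algebra_simps)
  also have "2 * \<beta> * inner a b \<le> \<beta> * inner a a + \<beta> * inner b b"
  proof -
    have "0 \<le> \<beta> * inner (a - b) (a - b)" using assms(7) by simp
    then show ?thesis by (simp add: inner_simps inner_commute algebra_simps)
  qed
  also have "(1 - 2 * \<beta>) * inner a p \<le> norm a * norm p"
  proof -
    \<comment> \<open>The coefficient may have either sign, hence the absolute values.\<close>
    have "\<bar>1 - 2 * \<beta>\<bar> * \<bar>inner a p\<bar> \<le> 1 * (norm a * norm p)"
      using assms(7,8) Cauchy_Schwarz_ineq2[of a p] by (intro mult_mono) auto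
    then show ?thesis using abs_ge_self[of "(1 - 2 * \<beta>) * inner a p"] by (simp add: abs_mult)
  qed
  also have "inner b p \<le> norm b * norm p" by (rule norm_cauchy_schwarz)
  finally have *: "inner y (b - a) \<le>
      (norm a * norm p - (1 - \<beta>) * (norm a)\<^sup>2) + (norm b * norm p - (1 - \<beta>) * (norm b)\<^sup>2)"
    by (simp add: power2_norm_eq_inner algebra_simps)
  \<comment> \<open>Completing the square; each of \<open>norm a\<close> and \<open>norm b\<close>
    takes half of the final bound.\<close>
  have quad: "s * norm p - (1 - \<beta>) * s\<^sup>2 \<le> (norm p)\<^sup>2 / (2 * (1 - \<beta>)) / 2" for s
  proof -
    have "0 \<le> (2 * (1 - \<beta>) * s - norm p)\<^sup>2" by simp
    then show ?thesis
      using assms(8) by (simp add: field_simps power2_eq_square)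
  qed
  have "inner y (b - a) \<le> (norm p)\<^sup>2 / (2 * (1 - \<beta>))"
    using * quad[of "norm a"] quad[of "norm b"] by linarith
  then show ?thesis by (simp add: a_def b_def)
qed

text \<open>The fixed points \<open>y\<close> of \<open>(1 - s) T\<close> may be unbounded as s
  tends to 0, but the inner product of \<open>y\<close> with \<open>T y - y\<close> is bounded above
  uniformly, and this alone forces \<open>T y - y\<close> to be small.\<close>

lemma AAMR_approx_fixed_point:
  fixes C D :: "'a::{real_inner, complete_space} set"
  assumes "closed C" "convex C" and "closed D" "convex D" and "C \<inter> D \<noteq> {}"
    and "0 < \<alpha>" "\<alpha> < 1" and "0 < \<beta>" "\<beta> < 1" and "\<epsilon> > 0"
  shows "\<exists>y. norm (y - AAMR C D \<alpha> \<beta> y) < \<epsilon>"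
proof -
  define T where "T = AAMR C D \<alpha> \<beta>"
  obtain p where p: "p \<in> C" "p \<in> D" using assms(5) by blast
  \<comment> \<open>The bound of \<open>metric_proj_gap_inner_le\<close> scaled by the factor in
    \<open>AAMR_diff\<close>; it does not depend on the later choice of \<open>s\<close> or
    \<open>y\<close>.\<close>
  define K where "K = 2 * \<alpha> * \<beta> * ((norm p)\<^sup>2 / (2 * (1 - \<beta>)))"
  have "K \<ge> 0" using assms by (simp add: K_def)
  have nonexp: "norm (T x - T y) \<le> norm (x - y)" for x y
  proof -
    have "0 \<le> (1 - \<alpha>) / \<alpha> * (norm ((x - T x) - (y - T y)))\<^sup>2" using assms by simp
    moreover have "(norm (T x - T y))\<^sup>2 + (1 - \<alpha>) / \<alpha> * (norm ((x - T x) - (y - T y)))\<^sup>2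
        \<le> (norm (x - y))\<^sup>2"
      unfolding T_def using assms p by (intro AAMR_averaged) auto
    ultimately have "(norm (T x - T y))\<^sup>2 \<le> (norm (x - y))\<^sup>2" by linarith
    then show ?thesis by (rule power2_le_imp_le) simp
  qed
  \<comment> \<open>Chosen so that s K < (1 - s) \<epsilon>^2; the summand 1 makes this strict and
    gives s < 1.\<close>
  define s where "s = \<epsilon>\<^sup>2 / (K + \<epsilon>\<^sup>2 + 1)"
  have s: "0 < s" "s < 1" using \<open>K \<ge> 0\<close> assms(10) by (auto simp: s_def field_simps add_pos_nonneg)
  have "\<exists>!y. (1 - s) *\<^sub>R T y = y"
  proof (rule banach_fix_type)
    show "0 \<le> 1 - s" "1 - s < 1" using s by auto
    show "\<forall>x y. dist ((1 - s) *\<^sub>R T x) ((1 - s) *\<^sub>R T y) \<le> (1 - s) * dist x y"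
      using nonexp s by (simp add: dist_norm flip: scaleR_diff_right)
  qed
  then obtain y where y: "(1 - s) *\<^sub>R T y = y" by blast
  define g where "g = T y - y"
  have gap: "inner y g \<le> K"
  proof -
    have "inner y g = 2 * \<alpha> * \<beta> * inner y (metric_proj D (mod_refl C \<beta> y) - metric_proj C y)"
      unfolding g_def T_def AAMR_diff by simp
    also have "\<dots> \<le> K"
      unfolding K_def using assms p by (intro mult_left_mono metric_proj_gap_inner_le) auto
    finally show ?thesis .
  qed
  have sy: "s *\<^sub>R y = (1 - s) *\<^sub>R g"
  proof -
    have "(1 - s) *\<^sub>R g = (1 - s) *\<^sub>R T y - (1 - s) *\<^sub>R y" by (simp add: g_def scaleR_diff_right)
    also have "\<dots> = s *\<^sub>R y" unfolding y by (simp add: scaleR_diff_left)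
    finally show ?thesis by simp
  qed
  \<comment> \<open>Pairing \<open>sy\<close> with \<open>g\<close> turns the upper bound on
    \<open>inner y g\<close> into a bound on the norm of \<open>g\<close>.\<close>
  have "(1 - s) * inner g g = s * inner y g"
    using arg_cong[OF sy, of "\<lambda>u. inner u g"] by simp
  also have "\<dots> \<le> s * K" using gap s by simp
  finally have *: "(1 - s) * (norm g)\<^sup>2 \<le> s * K" by (simp add: power2_norm_eq_inner)
  have "(1 - s) * \<epsilon>\<^sup>2 > s * K"
  proof -
    have "K + \<epsilon>\<^sup>2 + 1 > 0" using \<open>K \<ge> 0\<close> by (simp add: add_nonneg_pos)
    then have "s * (K + \<epsilon>\<^sup>2 + 1) = \<epsilon>\<^sup>2" by (simp add: s_def)
    then show ?thesis using s(1) by (simp add: algebra_simps)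
  qed
  with * have "(1 - s) * (norm g)\<^sup>2 < (1 - s) * \<epsilon>\<^sup>2" by linarith
  then have "(norm g)\<^sup>2 < \<epsilon>\<^sup>2" using s by simp
  then have "norm g < \<epsilon>" by (rule power2_less_imp_less) (use assms(10) in simp)
  then show ?thesis by (auto simp: g_def T_def norm_minus_commute)
qed

lemma AAMR_asymptotically_regular:
  fixes C D :: "'a::{real_inner, complete_space} set"
  assumes "closed C" "convex C" and "closed D" "convex D" and "C \<inter> D \<noteq> {}"
    and "0 < \<alpha>" "\<alpha> < 1" and "0 < \<beta>" "\<beta> < 1"
    and z: "\<And>n. z (Suc n) = AAMR C D \<alpha> \<beta> (z n)"
  shows "(\<lambda>n. metric_proj C (z n) - metric_proj D (mod_refl C \<beta> (z n))) \<longlonglongrightarrow> 0"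
proof -
  define T where "T = AAMR C D \<alpha> \<beta>"
  have nonempty: "C \<noteq> {}" "D \<noteq> {}" using assms(5) by auto
  have "(T ^^ n) (z 0) = z n" for n
    by (induction n) (auto simp: z T_def)
  moreover have "(\<lambda>n. (T ^^ n) (z 0) - T ((T ^^ n) (z 0))) \<longlonglongrightarrow> 0"
    unfolding T_def
  proof (rule asymptotically_regular[where \<kappa> = "(1 - \<alpha>) / \<alpha>"])
    show "(1 - \<alpha>) / \<alpha> > 0" using assms by simp
    show "\<exists>y. norm (y - AAMR C D \<alpha> \<beta> y) < \<epsilon>" if "\<epsilon> > 0" for \<epsilon>
      using AAMR_approx_fixed_point[OF assms(1-9) that] .
  qed (rule AAMR_averaged[OF assms(1,2) nonempty(1) assms(3,4) nonempty(2) assms(6)],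
      use assms(8,9) in auto)
  ultimately have "(\<lambda>n. z n - T (z n)) \<longlonglongrightarrow> 0" by simp
  \<comment> \<open>Undoes the factor in \<open>AAMR_diff\<close>, so that displacements become gaps
    between the two projections.\<close>
  then have "(\<lambda>n. (1 / (2 * \<alpha> * \<beta>)) *\<^sub>R (z n - T (z n))) \<longlonglongrightarrow> 0"
    using tendsto_scaleR[OF tendsto_const[of "1 / (2 * \<alpha> * \<beta>)"]] by (metis scaleR_zero_right)
  moreover have "z n - T (z n) =
      (2 * \<alpha> * \<beta>) *\<^sub>R (metric_proj C (z n) - metric_proj D (mod_refl C \<beta> (z n)))" for n
    using AAMR_diff[of C D \<alpha> \<beta> "z n"] by (simp add: T_def algebra_simps)
  ultimately show ?thesis using assms by simp
qed

text \<open>The ball about b + \<gamma>e of radius \<gamma>\<delta> is b + \<gamma> ball(e,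
  \<delta>), and a convex cone is closed under sums and nonnegative multiples. The radius is the
  same for all \<open>b\<close>.\<close>

lemma cone_near_shift_interior:
  fixes B :: "'a::real_normed_vector set"
  assumes "convex B" "cone B" and "ball e \<delta> \<subseteq> B" and "\<gamma> > 0"
    and "b \<in> B" and "dist x (b + \<gamma> *\<^sub>R e) < \<gamma> * \<delta>"
  shows "x \<in> interior B"
proof (rule interiorI)
  show "open (ball (b + \<gamma> *\<^sub>R e) (\<gamma> * \<delta>))" by simp
  show "x \<in> ball (b + \<gamma> *\<^sub>R e) (\<gamma> * \<delta>)" using assms(6) by (simp add: dist_commute)
  show "ball (b + \<gamma> *\<^sub>R e) (\<gamma> * \<delta>) \<subseteq> B"
  proof
    fix y assume "y \<in> ball (b + \<gamma> *\<^sub>R e) (\<gamma> * \<delta>)"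
    then have "norm (\<gamma> *\<^sub>R e - (y - b)) < \<gamma> * \<delta>" by (simp add: dist_norm algebra_simps)
    moreover have "\<gamma> *\<^sub>R e - (y - b) = \<gamma> *\<^sub>R (e - (1 / \<gamma>) *\<^sub>R (y - b))"
      using assms(4) by (simp add: scaleR_diff_right)
    ultimately have "norm (e - (1 / \<gamma>) *\<^sub>R (y - b)) < \<delta>"
      using assms(4) by simp
    then have "(1 / \<gamma>) *\<^sub>R (y - b) \<in> B" using assms(3) by (auto simp: dist_norm)
    moreover have closed_ops: "\<And>u v. u \<in> B \<Longrightarrow> v \<in> B \<Longrightarrow> u + v \<in> B"
      "\<And>u c. u \<in> B \<Longrightarrow> 0 \<le> c \<Longrightarrow> c *\<^sub>R u \<in> B"
      using convex_cone[of B] assms(1,2) by auto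
    ultimately have "\<gamma> *\<^sub>R (1 / \<gamma>) *\<^sub>R (y - b) \<in> B" using assms(4) by (metis less_imp_le)
    then have "y - b \<in> B" using assms(4) by simp
    then show "y \<in> B" using closed_ops(1)[OF assms(5)] by fastforce
  qed
qed

theorem theorem5p1:
  fixes A B :: "'a::{real_inner, complete_space} set"
    and e z0 :: 'a
    and \<gamma> \<alpha> \<beta> :: real
    and w z :: "nat \<Rightarrow> 'a"
  assumes "closed A" and "convex A"
    and "closed B" and "convex B" and "cone B"
    and "A \<inter> interior B \<noteq> {}"
    and "e \<in> interior B" and "\<gamma> > 0"
    and "A \<inter> (\<lambda>b. b + \<gamma> *\<^sub>R e) ` B \<noteq> {}"
    and "0 < \<alpha>" and "\<alpha> < 1" and "0 < \<beta>" and "\<beta> < 1"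
    and "z 0 = z0"
    and "\<And>n. w n = metric_proj A (z n)"
    and "\<And>n. z (Suc n) = AAMR A ((\<lambda>b. b + \<gamma> *\<^sub>R e) ` B) \<alpha> \<beta> (z n)"
  shows "\<exists>l0. \<forall>l\<ge>l0. w l \<in> A \<inter> interior B"
proof -
  define D where "D = (\<lambda>b. b + \<gamma> *\<^sub>R e) ` B"
  have D: "closed D" "convex D" "A \<inter> D \<noteq> {}"
    using assms closed_translation[of B "\<gamma> *\<^sub>R e"] convex_translation[of B "\<gamma> *\<^sub>R e"]
    by (auto simp: D_def add.commute)
  obtain \<delta> where \<delta>: "\<delta> > 0" "ball e \<delta> \<subseteq> B"
    using \<open>e \<in> interior B\<close> by (auto simp: mem_interior)
  define v where "v n = metric_proj D (mod_refl A \<beta> (z n))" for n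
  have "(\<lambda>n. w n - v n) \<longlonglongrightarrow> 0"
    unfolding v_def \<open>\<And>n. w n = metric_proj A (z n)\<close>
    using assms D by (intro AAMR_asymptotically_regular[where \<alpha> = \<alpha>]) (auto simp: D_def)
  \<comment> \<open>One tolerance \<gamma>\<delta> serves every \<open>l\<close>, although the
    nearby point \<open>v l\<close> of \<open>D\<close> varies.\<close>
  then obtain l0 where l0: "norm (w l - v l - 0) < \<gamma> * \<delta>" if "l \<ge> l0" for l
    using LIMSEQ_D[OF _ mult_pos_pos[OF \<open>\<gamma> > 0\<close> \<delta>(1)]] by blast
  have "w l \<in> A \<inter> interior B" if "l \<ge> l0" for l
  proof
    show "w l \<in> A" using assms by (auto intro!: metric_proj_in)
    have "v l \<in> D" unfolding v_def using D by (intro metric_proj_in) auto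
    then obtain b where "b \<in> B" "v l = b + \<gamma> *\<^sub>R e" by (auto simp: D_def)
    then show "w l \<in> interior B"
      using l0[OF that] \<delta>(2) assms
      by (intro cone_near_shift_interior[of B e \<delta> \<gamma> b]) (auto simp: dist_norm)
  qed
  then show ?thesis by blast
qed

end
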